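(* Let $A\in\mathbb{M}_d$ be a normal matrix and let $\mathcal{S}$ be a hyperplane of $\mathbb{C}^d$ orthogonal to the unit vector $h$. Set $\beta=\|Ah\|^2-|\langle h,Ah\rangle|^2$. Then, for $j=1,\ldots,d-1$, $$\mu_j^2(A)\ \ge\ \mu_j^2(A_{\mathcal{S}})\ \ge\ \mu_{j+1}^2(A)-\beta.$$
   Context: $\mathbb{M}_d$ is the space of complex $d\times d$ matrices, acting on $\mathbb{C}^d$ with inner product $\langle h,x\rangle=h^*x$ and Euclidean norm. A hyperplane is a vector subspace of dimension $d-1$; here $\mathcal{S}=h^\perp$. The compression $A_{\mathcal{S}}$ is the operator on $\mathcal{S}$ defined as the restriction to $\mathcal{S}$ of $EA$, where $E$ is the orthogonal projection of $\mathbb{C}^d$ onto $\mathcal{S}$. $\mu_1\ge\mu_2\ge\cdots$ denote singular values in nonincreasing order (with multiplicity). *)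

theory Defs
  imports "HOL-Analysis.Analysis" "HOL-Library.Multiset"
begin

definition cinner :: "complex ^ 'n \<Rightarrow> complex ^ 'n \<Rightarrow> complex" where
  "cinner h x = (\<Sum>i\<in>UNIV. cnj (h $ i) * x $ i)"

definition hermitian_adjoint :: "complex ^ 'n ^ 'm \<Rightarrow> complex ^ 'm ^ 'n" where
  "hermitian_adjoint A = (\<chi> i j. cnj (A $ j $ i))"

definition normal_matrix :: "complex ^ 'n ^ 'n \<Rightarrow> bool" where
  "normal_matrix A \<longleftrightarrow> A ** hermitian_adjoint A = hermitian_adjoint A ** A"

text \<open>The prefix \<open>vec\<close> refers to the vector space structure over the scalar field of the
  components, so the dimension below is the complex one.\<close>

definition hyperplane :: "(complex ^ 'n) set \<Rightarrow> bool" where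
  "hyperplane S \<longleftrightarrow> vec.subspace S \<and> vec.dim S = CARD('n) - 1"

definition orth_proj :: "(complex ^ 'n) set \<Rightarrow> complex ^ 'n \<Rightarrow> complex ^ 'n" where
  "orth_proj S x = (THE y. y \<in> S \<and> (\<forall>z\<in>S. cinner z (x - y) = 0))"

definition compression :: "complex ^ 'n ^ 'n \<Rightarrow> (complex ^ 'n) set \<Rightarrow> complex ^ 'n \<Rightarrow> complex ^ 'n" where
  "compression A S = (\<lambda>x\<in>S. orth_proj S (A *v x))"

text \<open>In the following definitions \<open>S\<close> is a complex subspace and \<open>T\<close> a linear operator
  from \<open>S\<close> to \<open>S\<close>; values of \<open>T\<close> outside \<open>S\<close> are never used.\<close>

definition adjoint_on :: "(complex ^ 'n) set \<Rightarrow> (complex ^ 'n \<Rightarrow> complex ^ 'n) \<Rightarrow> complex ^ 'n \<Rightarrow> complex ^ 'n" where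
  "adjoint_on S T x = (THE z. z \<in> S \<and> (\<forall>y\<in>S. cinner z y = cinner x (T y)))"

text \<open>Singular values are the square roots of the eigenvalues of \<open>T\<^sup>* T\<close>. As this operator is
  self-adjoint, the multiplicity of an eigenvalue is the dimension of its eigenspace.\<close>

definition sing_mult :: "(complex ^ 'n) set \<Rightarrow> (complex ^ 'n \<Rightarrow> complex ^ 'n) \<Rightarrow> real \<Rightarrow> nat" where
  "sing_mult S T s = vec.dim {x \<in> S. adjoint_on S T (T x) = complex_of_real (s\<^sup>2) *s x}"

definition sing_mset :: "(complex ^ 'n) set \<Rightarrow> (complex ^ 'n \<Rightarrow> complex ^ 'n) \<Rightarrow> real multiset" where
  "sing_mset S T = (\<Sum>s\<in>{s. 0 \<le> s \<and> 0 < sing_mult S T s}. replicate_mset (sing_mult S T s) s)"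

text \<open>The \<open>j\<close>-th largest singular value, with \<open>j\<close> starting from 1 and ranging up to the
  dimension of \<open>S\<close>.\<close>

definition singular_value :: "(complex ^ 'n) set \<Rightarrow> (complex ^ 'n \<Rightarrow> complex ^ 'n) \<Rightarrow> nat \<Rightarrow> real" where
  "singular_value S T j = rev (sorted_list_of_multiset (sing_mset S T)) ! (j - 1)"

lemma cinner_adjoint: "cinner (hermitian_adjoint A *v x) y = cinner x (A *v y)"
proof -
  have "cinner (hermitian_adjoint A *v x) y = (\<Sum>i\<in>UNIV. \<Sum>k\<in>UNIV. A $ k $ i * cnj (x $ k) * y $ i)"
    by (simp add: cinner_def hermitian_adjoint_def matrix_vector_mult_def sum_distrib_right)
  also have "\<dots> = (\<Sum>k\<in>UNIV. \<Sum>i\<in>UNIV. A $ k $ i * cnj (x $ k) * y $ i)"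
    by (rule sum.swap)
  also have "\<dots> = cinner x (A *v y)"
    by (simp add: cinner_def matrix_vector_mult_def sum_distrib_left mult_ac)
  finally show ?thesis .
qed

lemma adjoint_on_UNIV: "adjoint_on UNIV ((*v) A) = (*v) (hermitian_adjoint A)"
proof
  fix x
  have "z = hermitian_adjoint A *v x" if z: "\<And>y. cinner z y = cinner x (A *v y)" for z
  proof -
    have "cinner z (axis i 1) = cinner (hermitian_adjoint A *v x) (axis i 1)" for i
      by (simp add: z cinner_adjoint)
    moreover have "cinner u (axis i 1) = cnj (u $ i)" for u :: "complex ^ 'a" and i
      by (simp add: cinner_def axis_def if_distrib cong: if_cong)
    ultimately show ?thesis
      by (simp add: vec_eq_iff)
  qed
  then show "adjoint_on UNIV ((*v) A) x = hermitian_adjoint A *v x"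
    unfolding adjoint_on_def by (intro the_equality) (auto simp: cinner_adjoint)
qed

end

theory Submission
  imports Defs
begin

text \<open>On the hyperplane \<open>S\<close>, which is the orthogonal complement of \<open>h\<close>, the compression is
  \<open>C x = A x - \<langle>h, A x\<rangle> h\<close>, so Pythagoras gives
  \<open>\<parallel>C x\<parallel>\<^sup>2 = \<parallel>A x\<parallel>\<^sup>2 - \<bar>\<langle>h, A x\<rangle>\<bar>\<^sup>2\<close>. The error term is at most \<open>\<beta> \<parallel>x\<parallel>\<^sup>2\<close>
  (\<open>normal_defect_bound\<close>): it equals \<open>\<bar>\<langle>A\<^sup>* h, x\<rangle>\<bar>\<^sup>2\<close>, in which only the part of \<open>A\<^sup>* h\<close>
  orthogonal to \<open>h\<close> counts, and normality makes the squared length of that part equal to \<open>\<beta>\<close>.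
  Hence \<open>\<parallel>A x\<parallel>\<^sup>2 - \<beta> \<parallel>x\<parallel>\<^sup>2 \<le> \<parallel>C x\<parallel>\<^sup>2 \<le> \<parallel>A x\<parallel>\<^sup>2\<close> on \<open>S\<close>.

  Such pointwise bounds pass to singular values by the dimension count behind the Courant-Fischer
  theorem (\<open>singular_value_comparison\<close>). The first \<open>j\<close> singular vectors of one operator span a
  space where it stretches by at least its \<open>j\<close>-th singular value; those of the other operator from
  the \<open>k\<close>-th on span a space where it stretches by at most its \<open>k\<close>-th one. If the two dimensions
  add up to more than that of the whole space, the two spaces share a nonzero vector, at which the
  pointwise bound is evaluated. As \<open>S\<close> has codimension one, this works with equal indices when the
  large stretching is that of \<open>C\<close>, and with indices \<open>j + 1\<close> and \<open>j\<close> when it is that of \<open>A\<close>.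

  The singular vectors come from \<open>exists_singular_basis\<close>: an orthonormal basis with orthogonal
  images, found by maximizing \<open>\<parallel>T x\<parallel>\<close> repeatedly. It diagonalizes \<open>T\<^sup>* T\<close>, so the multiset of
  singular values, defined through eigenspaces, consists of the numbers \<open>\<parallel>T b\<parallel>\<close> for \<open>b\<close> in the
  basis (\<open>sing_mset_singular_basis\<close>).\<close>

section \<open>The Hermitian inner product\<close>

lemma cinner_add_right: "cinner x (y + z) = cinner x y + cinner x z"
  by (simp add: cinner_def algebra_simps sum.distrib)

lemma cinner_diff_right: "cinner x (y - z) = cinner x y - cinner x z"
  by (simp add: cinner_def algebra_simps sum_subtractf)

lemma cinner_scale_right: "cinner x (c *s y) = c * cinner x y"
  by (simp add: cinner_def sum_distrib_left mult_ac)

lemma cinner_zero_right [simp]: "cinner x 0 = 0"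
  by (simp add: cinner_def)

lemma cinner_sum_right: "cinner x (sum f I) = (\<Sum>i\<in>I. cinner x (f i))"
  by (induction I rule: infinite_finite_induct) (auto simp: cinner_add_right)

lemma cnj_cinner: "cnj (cinner x y) = cinner y x"
  by (simp add: cinner_def mult.commute)

lemma cinner_diff_left: "cinner (x - y) z = cinner x z - cinner y z"
  by (simp add: cinner_def algebra_simps sum_subtractf)

lemma cinner_scale_left: "cinner (c *s x) y = cnj c * cinner x y"
  by (simp add: cinner_def sum_distrib_left mult_ac)

lemma cinner_sum_left: "cinner (sum f I) x = (\<Sum>i\<in>I. cinner (f i) x)"
  by (metis (no_types, lifting) cinner_sum_right cnj_cinner cnj_sum sum.cong)

lemma Re_cinner: "Re (cinner x y) = x \<bullet> y"
  by (simp add: cinner_def inner_vec_def inner_complex_def)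

lemma cinner_self: "cinner x x = of_real ((norm x)\<^sup>2)"
proof -
  have "Im (cinner x x) = 0"
    by (simp add: cinner_def)
  then show ?thesis
    by (simp add: complex_eq_iff Re_cinner power2_norm_eq_inner)
qed

lemma norm_cscale: "norm (c *s x) = cmod c * norm (x :: complex ^ 'n)"
proof -
  have "complex_of_real ((norm (c *s x))\<^sup>2) = of_real ((cmod c * norm x)\<^sup>2)"
    unfolding cinner_self[symmetric] cinner_scale_left cinner_scale_right
    by (simp add: cinner_self power_mult_distrib complex_norm_square mult_ac del: of_real_power)
  then have "(norm (c *s x))\<^sup>2 = (cmod c * norm x)\<^sup>2"
    using of_real_eq_iff by blast
  then show ?thesis
    by (simp add: power2_eq_iff_nonneg)
qed

lemma scaleR_eq_cscale: "r *\<^sub>R x = complex_of_real r *s (x :: complex ^ 'n)"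
  by (simp add: vec_eq_iff scaleR_conv_of_real[where 'a = complex])

text \<open>Multiplying \<open>x\<close> by \<open>cinner x y\<close> makes the product real and nonnegative, which reduces the
  claim to the real Cauchy-Schwarz inequality.\<close>

lemma cinner_Cauchy_Schwarz: "cmod (cinner x y) \<le> norm x * norm y"
proof -
  have "(cmod (cinner x y))\<^sup>2 = Re (cinner (cinner x y *s x) y)"
    by (simp add: cinner_scale_left complex_norm_square[symmetric] mult.commute
        flip: of_real_power)
  also have "\<dots> \<le> norm (cinner x y *s x) * norm y"
    unfolding Re_cinner by (rule norm_cauchy_schwarz)
  finally have "cmod (cinner x y) * cmod (cinner x y) \<le> cmod (cinner x y) * (norm x * norm y)"
    by (simp add: norm_cscale power2_eq_square mult_ac)
  then show ?thesis
    by (cases "cinner x y = 0") auto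
qed

lemma norm_sum_orthogonal:
  fixes f :: "'i \<Rightarrow> complex ^ 'n"
  assumes "finite I" and "\<And>i k. i \<in> I \<Longrightarrow> k \<in> I \<Longrightarrow> i \<noteq> k \<Longrightarrow> cinner (f i) (f k) = 0"
  shows "(norm (\<Sum>i\<in>I. c i *s f i))\<^sup>2 = (\<Sum>i\<in>I. (cmod (c i))\<^sup>2 * (norm (f i))\<^sup>2)"
proof -
  have "pairwise (\<lambda>i k. orthogonal (c i *s f i) (c k *s f k)) I"
    using assms(2)
    by (auto simp: pairwise_def orthogonal_def cinner_scale_left cinner_scale_right simp flip: Re_cinner)
  from norm_sum_Pythagorean[OF assms(1) this] show ?thesis
    by (simp add: norm_cscale power_mult_distrib)
qed

section \<open>Orthonormal sets\<close>

definition orthonormal :: "(complex ^ 'n) set \<Rightarrow> bool" where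
  "orthonormal B \<longleftrightarrow> (\<forall>b\<in>B. \<forall>c\<in>B. cinner b c = (if b = c then 1 else 0))"

lemma orthonormal_subset: "orthonormal B \<Longrightarrow> C \<subseteq> B \<Longrightarrow> orthonormal C"
  unfolding orthonormal_def by blast

lemma cinner_orthonormal_sum:
  assumes "orthonormal B" "finite B" "b \<in> B"
  shows "cinner b (\<Sum>v\<in>B. u v *s v) = u b"
proof -
  have "cinner b (\<Sum>v\<in>B. u v *s v) = (\<Sum>v\<in>B. if v = b then u v else 0)"
    unfolding cinner_sum_right cinner_scale_right
    using assms by (intro sum.cong) (auto simp: orthonormal_def)
  then show ?thesis
    using assms by simp
qed

lemma orthonormal_independent:
  assumes "orthonormal B" "finite B"
  shows "vec.independent B"
  unfolding vec.independent_explicit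
  using assms cinner_orthonormal_sum[OF assms] by (metis cinner_zero_right)

lemma orthonormal_dim_span:
  assumes "orthonormal B" "finite B"
  shows "vec.dim (vec.span B) = card B"
  using orthonormal_independent[OF assms] by (rule vec.dim_span_eq_card_independent)

lemma orthonormal_expansion:
  assumes "orthonormal B" "finite B" "x \<in> vec.span B"
  shows "x = (\<Sum>b\<in>B. cinner b x *s b)"
proof -
  obtain u where u: "x = (\<Sum>v\<in>B. u v *s v)"
    using assms(3) vec.span_finite[OF assms(2)] by auto
  have "u b = cinner b x" if "b \<in> B" for b
    using cinner_orthonormal_sum[OF assms(1,2) that] u by simp
  then have "(\<Sum>b\<in>B. cinner b x *s b) = (\<Sum>b\<in>B. u b *s b)"
    by (intro sum.cong) auto
  then show ?thesis
    using u by metis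
qed

section \<open>The singular value decomposition\<close>

abbreviation clinear :: "(complex ^ 'n \<Rightarrow> complex ^ 'n) \<Rightarrow> bool" where
  "clinear \<equiv> Vector_Spaces.linear (*s) (*s)"

lemma clinear_iff:
  "clinear T \<longleftrightarrow> (\<forall>x y. T (x + y) = T x + T y) \<and> (\<forall>c x. T (c *s x) = c *s T x)"
  unfolding Vector_Spaces.linear_iff by (auto intro: vec.vector_space_axioms)

lemma clinear_imp_linear: "clinear T \<Longrightarrow> linear T"
  by (intro linearI) (simp_all add: clinear_iff scaleR_eq_cscale)

lemma csubspace_imp_subspace:
  fixes V :: "(complex ^ 'n) set"
  shows "vec.subspace V \<Longrightarrow> subspace V"
  by (auto simp: subspace_def vec.subspace_def scaleR_eq_cscale)

text \<open>The unit sphere of \<open>V\<close> is compact, and homogeneity extends the bound from it to \<open>V\<close>.\<close>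

lemma exists_maximizing_vector:
  fixes V :: "(complex ^ 'n) set"
  assumes T: "clinear T" and V: "vec.subspace V" and "V \<noteq> {0}"
  obtains e where "e \<in> V" "norm e = 1" "\<And>x. x \<in> V \<Longrightarrow> norm (T x) \<le> norm (T e) * norm x"
proof -
  let ?K = "V \<inter> sphere 0 1"
  have sub: "subspace V"
    using V by (rule csubspace_imp_subspace)
  have lin: "linear T"
    using T by (rule clinear_imp_linear)
  have unit: "(1 / norm x) *\<^sub>R x \<in> ?K" if "x \<in> V" "x \<noteq> 0" for x
    using that sub by (simp add: subspace_scale)
  obtain x0 where "x0 \<in> V" "x0 \<noteq> 0"
    using V \<open>V \<noteq> {0}\<close> vec.subspace_0 by blast
  then have "?K \<noteq> {}"
    using unit by blast
  moreover have "compact ?K"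
    using closed_subspace[OF sub] by (simp add: closed_Int_compact)
  moreover have "continuous_on ?K (\<lambda>x. norm (T x))"
    using lin by (intro continuous_on_norm linear_continuous_on) (simp add: linear_conv_bounded_linear)
  ultimately obtain e where e: "e \<in> ?K" "\<And>y. y \<in> ?K \<Longrightarrow> norm (T y) \<le> norm (T e)"
    using continuous_attains_sup[of ?K "\<lambda>x. norm (T x)"] by blast
  have "norm (T x) \<le> norm (T e) * norm x" if "x \<in> V" for x
  proof (cases "x = 0")
    case True
    then show ?thesis using linear_0[OF lin] by simp
  next
    case False
    have "norm (T ((1 / norm x) *\<^sub>R x)) \<le> norm (T e)"
      using e(2) unit[OF that False] by blast
    then show ?thesis
      using False by (simp add: linear_scale[OF lin] field_simps)
  qed
  with e(1) show ?thesis
    by (intro that[of e]) auto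
qed

text \<open>First-order optimality: moving from \<open>e\<close> towards \<open>y\<close> by a small multiple, with the phase
  chosen to cancel that of \<open>cinner (T e) (T y)\<close>, would increase \<open>norm (T x) / norm x\<close> to first
  order while changing \<open>norm x\<close> only to second order.\<close>

lemma maximizing_vector_orthogonal:
  assumes T: "clinear T" and V: "vec.subspace V" and e: "e \<in> V" "norm e = 1"
    and max: "\<And>x. x \<in> V \<Longrightarrow> norm (T x) \<le> norm (T e) * norm x"
    and y: "y \<in> V" "cinner e y = 0"
  shows "cinner (T e) (T y) = 0"
proof (rule ccontr)
  define g where "g = cinner (T e) (T y)"
  assume "cinner (T e) (T y) \<noteq> 0"
  then have g: "(cmod g)\<^sup>2 > 0"
    by (simp add: g_def)
  define K where "K = (norm (T e) * norm y)\<^sup>2"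
  \<comment> \<open>The gain is \<open>2 t (cmod g)\<^sup>2\<close> and the loss at most \<open>K t\<^sup>2 (cmod g)\<^sup>2\<close>, so any \<open>t\<close> with \<open>t * K < 2\<close>
    gives a contradiction.\<close>
  define t where "t = 1 / (K + 1)"
  have t: "t > 0" "t * K < 1"
    by (simp_all add: t_def K_def add_nonneg_pos)
  define c where "c = of_real t * cnj g"
  have expand: "(norm (u + c *s v))\<^sup>2 = (norm u)\<^sup>2 + 2 * Re (c * cinner u v) + (cmod c)\<^sup>2 * (norm v)\<^sup>2"
    for u v
  proof -
    have "(norm (u + c *s v))\<^sup>2 = (norm u)\<^sup>2 + 2 * (u \<bullet> (c *s v)) + (norm (c *s v))\<^sup>2"
      by (simp add: power2_norm_eq_inner inner_add inner_commute)
    then show ?thesis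
      by (simp add: norm_cscale power_mult_distrib cinner_scale_right flip: Re_cinner)
  qed
  have "e + c *s y \<in> V"
    using V e y by (simp add: vec.subspace_add vec.subspace_scale)
  then have "(norm (T (e + c *s y)))\<^sup>2 \<le> (norm (T e) * norm (e + c *s y))\<^sup>2"
    using max by (intro power_mono) auto
  moreover have "T (e + c *s y) = T e + c *s T y"
    using T by (simp add: clinear_iff)
  moreover have "Re (c * g) = t * (cmod g)\<^sup>2"
    by (simp add: c_def cmod_power2[of g] power2_eq_square[of "Re g"] power2_eq_square[of "Im g"] algebra_simps)
  moreover have "(cmod c)\<^sup>2 = t\<^sup>2 * (cmod g)\<^sup>2"
    by (simp add: c_def norm_mult power_mult_distrib)
  ultimately have "2 * (t * (cmod g)\<^sup>2) + t\<^sup>2 * (cmod g)\<^sup>2 * (norm (T y))\<^sup>2 \<le> t\<^sup>2 * (cmod g)\<^sup>2 * K"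
    by (simp add: expand power_mult_distrib y e K_def algebra_simps flip: g_def)
  moreover have "t\<^sup>2 * (cmod g)\<^sup>2 * (norm (T y))\<^sup>2 \<ge> 0"
    by simp
  ultimately have "2 * (t * (cmod g)\<^sup>2) \<le> (t * K) * (t * (cmod g)\<^sup>2)"
    by (simp add: power2_eq_square mult_ac)
  moreover have "t * (cmod g)\<^sup>2 > 0"
    using t g by simp
  ultimately show False
    using t(2) by (simp add: mult_le_cancel_right)
qed

text \<open>A basis of right singular vectors. The images are orthogonal but not normalized: the
  singular values are their norms.\<close>

definition singular_basis :: "(complex ^ 'n) set \<Rightarrow> (complex ^ 'n \<Rightarrow> complex ^ 'n) \<Rightarrow> (complex ^ 'n) set \<Rightarrow> bool"
  where "singular_basis V T B \<longleftrightarrow> finite B \<and> orthonormal B \<and> vec.span B = V \<and>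
    (\<forall>b\<in>B. \<forall>c\<in>B. b \<noteq> c \<longrightarrow> cinner (T b) (T c) = 0)"

text \<open>A unit vector maximizing \<open>norm (T x)\<close> is the first element of the basis. By first-order
  optimality, the image of its orthogonal complement is orthogonal to its own image, so the
  construction can be repeated in that complement.\<close>

lemma exists_singular_basis:
  assumes T: "clinear T" and "vec.subspace V"
  shows "\<exists>B. singular_basis V T B"
  using assms(2)
proof (induction "vec.dim V" arbitrary: V rule: less_induct)
  case less
  show ?case
  proof (cases "V = {0}")
    case True
    then have "singular_basis V T {}"
      by (simp add: singular_basis_def orthonormal_def)
    then show ?thesis ..
  next
    case False
    obtain e where e: "e \<in> V" "norm e = 1"
      and max: "\<And>x. x \<in> V \<Longrightarrow> norm (T x) \<le> norm (T e) * norm x"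
      using exists_maximizing_vector[OF T less.prems False] by metis
    have ee: "cinner e e = 1"
      by (simp add: cinner_self e)
    define W where "W = {y \<in> V. cinner e y = 0}"
    have W: "vec.subspace W"
      using less.prems by (auto simp: W_def vec.subspace_def cinner_add_right cinner_scale_right)
    have "e \<notin> W"
      using ee by (simp add: W_def)
    then have "W \<subset> V"
      using e(1) by (auto simp: W_def)
    then have "vec.dim W < vec.dim V"
      using W less.prems by (intro vec.dim_psubset) (simp add: vec.span_eq_iff[THEN iffD2])
    then obtain B where "singular_basis W T B"
      using less.hyps W by blast
    then have B: "finite B" "orthonormal B" "vec.span B = W"
      "\<And>b c. b \<in> B \<Longrightarrow> c \<in> B \<Longrightarrow> b \<noteq> c \<Longrightarrow> cinner (T b) (T c) = 0"
      by (auto simp: singular_basis_def)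
    have BW: "b \<in> V" "cinner e b = 0" if "b \<in> B" for b
      using B(3) that vec.span_base[of b B] by (auto simp: W_def)
    then have be: "cinner b e = 0" if "b \<in> B" for b
      using that cnj_cinner[of e b] by simp
    have Te: "cinner (T e) (T b) = 0" if "b \<in> B" for b
      using maximizing_vector_orthogonal[OF T less.prems e max] BW that by blast
    have eT: "cinner (T b) (T e) = 0" if "b \<in> B" for b
      using Te[OF that] cnj_cinner[of "T e" "T b"] by simp
    have "e \<notin> B"
      using BW ee by force
    have "vec.span (insert e B) = V"
    proof
      show "vec.span (insert e B) \<subseteq> V"
        using e BW less.prems by (intro vec.span_minimal) auto
      show "V \<subseteq> vec.span (insert e B)"
      proof
        fix x assume "x \<in> V"
        then have "x - cinner e x *s e \<in> vec.span B"
          using e less.prems ee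
          by (simp add: B(3) W_def vec.subspace_diff vec.subspace_scale cinner_diff_right cinner_scale_right)
        then show "x \<in> vec.span (insert e B)"
          by (auto simp: vec.span_insert)
      qed
    qed
    moreover have "orthonormal (insert e B)"
      using B(2) BW be ee \<open>e \<notin> B\<close> by (auto simp: orthonormal_def)
    ultimately have "singular_basis V T (insert e B)"
      using B(1,4) Te eT by (auto simp: singular_basis_def)
    then show ?thesis ..
  qed
qed

text \<open>The definite description in \<open>adjoint_on\<close> denotes a vector even if \<open>T\<close> does not map \<open>V\<close> into
  itself: \<open>\<Sum>b\<in>B. cinner (T b) x *s b\<close> satisfies it, and nondegeneracy of \<open>cinner\<close> on \<open>V\<close>
  makes it unique.\<close>

lemma adjoint_on_singular_basis:
  assumes T: "clinear T" and B: "singular_basis V T B"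
  shows "adjoint_on V T x \<in> V"
    and "y \<in> V \<Longrightarrow> cinner (adjoint_on V T x) y = cinner x (T y)"
proof -
  have fB: "finite B" and oB: "orthonormal B" and sB: "vec.span B = V"
    using B by (auto simp: singular_basis_def)
  let ?P = "\<lambda>z. z \<in> V \<and> (\<forall>y\<in>V. cinner z y = cinner x (T y))"
  have "?P (\<Sum>b\<in>B. cinner (T b) x *s b)"
  proof (intro conjI ballI)
    show "(\<Sum>b\<in>B. cinner (T b) x *s b) \<in> V"
      unfolding sB[symmetric] by (intro vec.span_sum vec.span_scale vec.span_base)
    fix y assume "y \<in> V"
    then have y: "y = (\<Sum>b\<in>B. cinner b y *s b)"
      using orthonormal_expansion[OF oB fB] sB by blast
    have "T (\<Sum>b\<in>B. cinner b y *s b) = (\<Sum>b\<in>B. cinner b y *s T b)"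
      using T by (simp add: vec.linear_sum vec.linear_scale)
    then have "cinner x (T y) = (\<Sum>b\<in>B. cinner b y * cinner x (T b))"
      using y by (simp add: cinner_sum_right cinner_scale_right)
    then show "cinner (\<Sum>b\<in>B. cinner (T b) x *s b) y = cinner x (T y)"
      by (simp add: cinner_sum_left cinner_scale_left cnj_cinner mult.commute)
  qed
  moreover have "z = z'" if "?P z" "?P z'" for z z'
  proof -
    have "z - z' \<in> V"
      using that sB vec.span_diff by blast
    then have "cinner (z - z') (z - z') = 0"
      using that by (simp add: cinner_diff_left)
    then show ?thesis
      by (simp add: cinner_self)
  qed
  ultimately have "?P (adjoint_on V T x)"
    unfolding adjoint_on_def by (intro theI'[of ?P]) blast
  then show "adjoint_on V T x \<in> V" "y \<in> V \<Longrightarrow> cinner (adjoint_on V T x) y = cinner x (T y)"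
    by auto
qed

text \<open>An eigenspace of a diagonal operator is spanned by the basis vectors with that eigenvalue.
  Since \<open>s\<close> and \<open>norm (T b)\<close> are nonnegative, they may be compared through their squares.\<close>

lemma sing_mult_singular_basis:
  assumes T: "clinear T" and B: "singular_basis V T B" and "0 \<le> s"
  shows "sing_mult V T s = card {b \<in> B. norm (T b) = s}"
proof -
  have fB: "finite B" and oB: "orthonormal B" and sB: "vec.span B = V"
    and TB: "\<And>b c. b \<in> B \<Longrightarrow> c \<in> B \<Longrightarrow> b \<noteq> c \<Longrightarrow> cinner (T b) (T c) = 0"
    using B by (auto simp: singular_basis_def)
  let ?C = "{b \<in> B. norm (T b) = s}"
  \<comment> \<open>In the basis \<open>B\<close> the operator \<open>T\<^sup>* T\<close> is diagonal, with entries \<open>(norm (T b))\<^sup>2\<close>.\<close>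
  have diag: "cinner b (adjoint_on V T (T x)) = of_real ((norm (T b))\<^sup>2) * cinner b x"
    if "b \<in> B" "x \<in> V" for b x
  proof -
    have "x = (\<Sum>v\<in>B. cinner v x *s v)"
      using orthonormal_expansion[OF oB fB] sB that(2) by blast
    moreover have "T (\<Sum>v\<in>B. cinner v x *s v) = (\<Sum>v\<in>B. cinner v x *s T v)"
      using T by (simp add: vec.linear_sum vec.linear_scale)
    ultimately have "cinner (T b) (T x) = (\<Sum>v\<in>B. cinner v x * cinner (T b) (T v))"
      by (simp add: cinner_sum_right cinner_scale_right)
    also have "\<dots> = (\<Sum>v\<in>B. if v = b then cinner v x * cinner (T b) (T v) else 0)"
      using TB that(1) by (intro sum.cong) auto
    also have "\<dots> = cinner b x * cinner (T b) (T b)"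
      using that(1) fB by simp
    finally have "cinner (T b) (T x) = of_real ((norm (T b))\<^sup>2) * cinner b x"
      by (simp add: cinner_self)
    moreover have "b \<in> V"
      using that(1) sB vec.span_base by blast
    ultimately show ?thesis
      using adjoint_on_singular_basis(2)[OF T B, of b "T x"] cnj_cinner
      by metis
  qed
  have expand: "x = (\<Sum>b\<in>B. cinner b x *s b)" if "x \<in> V" for x
    using orthonormal_expansion[OF oB fB] sB that by blast
  have "{x \<in> V. adjoint_on V T (T x) = complex_of_real (s\<^sup>2) *s x} = vec.span ?C"
  proof (intro set_eqI iffI)
    fix x assume "x \<in> {x \<in> V. adjoint_on V T (T x) = complex_of_real (s\<^sup>2) *s x}"
    then have x: "x \<in> V" "adjoint_on V T (T x) = complex_of_real (s\<^sup>2) *s x"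
      by auto
    have "cinner b x = 0" if "b \<in> B - ?C" for b
    proof -
      have "of_real (s\<^sup>2) * cinner b x = of_real ((norm (T b))\<^sup>2) * cinner b x"
        using diag[of b x] that x by (simp add: cinner_scale_right)
      moreover have "complex_of_real (s\<^sup>2) \<noteq> of_real ((norm (T b))\<^sup>2)"
        using that \<open>0 \<le> s\<close> by (auto simp: power2_eq_iff_nonneg simp del: of_real_power)
      ultimately show ?thesis
        by (metis mult_cancel_right)
    qed
    then have "(\<Sum>b\<in>B. cinner b x *s b) = (\<Sum>b\<in>?C. cinner b x *s b)"
      using fB by (intro sum.mono_neutral_right) auto
    then have "x = (\<Sum>b\<in>?C. cinner b x *s b)"
      using expand[OF x(1)] by simp
    also have "\<dots> \<in> vec.span ?C"
      by (intro vec.span_sum vec.span_scale vec.span_base)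
    finally show "x \<in> vec.span ?C" .
  next
    fix x assume xC: "x \<in> vec.span ?C"
    have "vec.span ?C \<subseteq> V"
      unfolding sB[symmetric] by (intro vec.span_mono) auto
    with xC have x: "x \<in> V"
      by blast
    obtain u where u: "x = (\<Sum>v\<in>?C. u v *s v)"
      using xC vec.span_finite[of ?C] fB by auto
    have "cinner b x = 0" if "b \<in> B - ?C" for b
      unfolding u cinner_sum_right cinner_scale_right
      using that oB by (intro sum.neutral) (auto simp: orthonormal_def)
    then have "cinner b (adjoint_on V T (T x)) = cinner b (complex_of_real (s\<^sup>2) *s x)" if "b \<in> B" for b
      using that diag[OF that x] by (cases "b \<in> ?C") (auto simp: cinner_scale_right)
    moreover have "complex_of_real (s\<^sup>2) *s x \<in> V"
      using x sB vec.span_scale by blast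
    ultimately have "adjoint_on V T (T x) = complex_of_real (s\<^sup>2) *s x"
      using expand[of "adjoint_on V T (T x)"] expand[of "complex_of_real (s\<^sup>2) *s x"]
        adjoint_on_singular_basis(1)[OF T B]
      by (metis (no_types, lifting) sum.cong)
    with x show "x \<in> {x \<in> V. adjoint_on V T (T x) = complex_of_real (s\<^sup>2) *s x}"
      by simp
  qed
  then have "sing_mult V T s = vec.dim (vec.span ?C)"
    by (simp add: sing_mult_def)
  also have "\<dots> = card ?C"
    using fB oB by (intro orthonormal_dim_span orthonormal_subset[OF oB]) auto
  finally show ?thesis .
qed

lemma sing_mset_singular_basis:
  assumes T: "clinear T" and B: "singular_basis V T B"
  shows "sing_mset V T = image_mset (\<lambda>b. norm (T b)) (mset_set B)"
proof (rule multiset_eqI)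
  fix s
  have fB: "finite B"
    using B by (simp add: singular_basis_def)
  let ?F = "{s. 0 \<le> s \<and> 0 < sing_mult V T s}"
  have "?F \<subseteq> (\<lambda>b. norm (T b)) ` B"
    by (force simp: sing_mult_singular_basis[OF T B] card_gt_0_iff)
  then have "finite ?F"
    using fB finite_subset by blast
  then have "count (sing_mset V T) s = (if s \<in> ?F then sing_mult V T s else 0)"
    by (simp add: sing_mset_def count_sum)
  also have "\<dots> = card {b \<in> B. norm (T b) = s}"
  proof (cases "0 \<le> s")
    case True
    then show ?thesis by (simp add: sing_mult_singular_basis[OF T B])
  next
    case False
    then have empty: "{b \<in> B. norm (T b) = s} = {}"
      using norm_ge_zero by auto
    show ?thesis
      unfolding empty using False by simp
  qed
  also have "\<dots> = count (image_mset (\<lambda>b. norm (T b)) (mset_set B)) s"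
    using fB by (simp add: count_image_mset' Int_def vimage_def conj_commute eq_commute)
  finally show "count (sing_mset V T) s = count (image_mset (\<lambda>b. norm (T b)) (mset_set B)) s" .
qed

section \<open>Comparison of singular values\<close>

text \<open>In the decreasing list of the numbers \<open>norm (T b)\<close>, the entries at positions
  \<open>1, \<dots>, j\<close> are at least the \<open>j\<close>-th one, and those at positions \<open>j, \<dots>, card B\<close> are at
  most that. Counting instead of choosing \<open>j\<close> vectors avoids having to break ties.\<close>

lemma singular_value_count:
  assumes T: "clinear T" and B: "singular_basis V T B" and j: "1 \<le> j" "j \<le> card B"
  shows "j \<le> card {b \<in> B. singular_value V T j \<le> norm (T b)}"
    and "card B < j + card {b \<in> B. norm (T b) \<le> singular_value V T j}"
proof -
  have fB: "finite B"
    using B by (simp add: singular_basis_def)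
  define xs where "xs = rev (sorted_list_of_multiset (sing_mset V T))"
  have mset: "mset xs = image_mset (\<lambda>b. norm (T b)) (mset_set B)"
    by (simp add: xs_def sing_mset_singular_basis[OF T B])
  have len: "length xs = card B"
    using arg_cong[OF mset, of size] by simp
  have desc: "xs ! k \<le> xs ! i" if "i \<le> k" "k < length xs" for i k
    using that sorted_rev_nth_mono[of xs i k] by (simp add: xs_def)
  have count: "card {b \<in> B. P (norm (T b))} = card {i. i < length xs \<and> P (xs ! i)}" for P
  proof -
    have "card {i. i < length xs \<and> P (xs ! i)} = size (filter_mset P (mset xs))"
      by (simp add: length_filter_conv_card flip: mset_filter)
    also have "\<dots> = card {b \<in> B. P (norm (T b))}"
      unfolding mset using fB by (simp add: filter_mset_image_mset filter_mset_mset_set)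
    finally show ?thesis ..
  qed
  have \<sigma>: "singular_value V T j = xs ! (j - 1)"
    by (simp add: singular_value_def xs_def)
  have "{..<j} \<subseteq> {i. i < length xs \<and> xs ! (j - 1) \<le> xs ! i}"
    using desc j len by auto
  then have "card {..<j} \<le> card {i. i < length xs \<and> xs ! (j - 1) \<le> xs ! i}"
    by (rule card_mono[rotated]) simp
  then show "j \<le> card {b \<in> B. singular_value V T j \<le> norm (T b)}"
    using count[of "\<lambda>r. singular_value V T j \<le> r"] by (simp add: \<sigma>)
  have "{j - 1..<card B} \<subseteq> {i. i < length xs \<and> xs ! i \<le> xs ! (j - 1)}"
    using desc j len by auto
  then have "card {j - 1..<card B} \<le> card {i. i < length xs \<and> xs ! i \<le> xs ! (j - 1)}"
    by (rule card_mono[rotated]) simp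
  then show "card B < j + card {b \<in> B. norm (T b) \<le> singular_value V T j}"
    using count[of "\<lambda>r. r \<le> singular_value V T j"] j by (simp add: \<sigma>)
qed

lemma singular_value_nonneg:
  assumes T: "clinear T" and V: "vec.subspace V" and j: "1 \<le> j" "j \<le> vec.dim V"
  shows "0 \<le> singular_value V T j"
proof -
  obtain B where B: "singular_basis V T B"
    using exists_singular_basis[OF T V] by blast
  then have "card B = vec.dim V"
    using orthonormal_dim_span[of B] by (simp add: singular_basis_def)
  then have "card {b \<in> B. norm (T b) \<le> singular_value V T j} > 0"
    using singular_value_count(2)[OF T B j(1)] j by simp
  then obtain b where "norm (T b) \<le> singular_value V T j"
    by (auto simp: card_gt_0_iff)
  then show ?thesis
    using norm_ge_zero order_trans by blast
qed

text \<open>In the coordinates of a singular basis, both \<open>(norm x)\<^sup>2\<close> and \<open>(norm (T x))\<^sup>2\<close> are weighted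
  sums of squares. On the span of part of the basis, bounds on \<open>norm (T b)\<close> thus become bounds on
  \<open>norm (T x) / norm x\<close>.\<close>

lemma norm_square_singular_basis:
  assumes T: "clinear T" and B: "singular_basis V T B" and C: "C \<subseteq> B" and x: "x \<in> vec.span C"
  shows "(norm x)\<^sup>2 = (\<Sum>b\<in>C. (cmod (cinner b x))\<^sup>2)"
    and "(norm (T x))\<^sup>2 = (\<Sum>b\<in>C. (cmod (cinner b x))\<^sup>2 * (norm (T b))\<^sup>2)"
proof -
  have fC: "finite C" and oC: "orthonormal C"
    and TC: "\<And>b c. b \<in> C \<Longrightarrow> c \<in> C \<Longrightarrow> b \<noteq> c \<Longrightarrow> cinner (T b) (T c) = 0"
    using B C finite_subset orthonormal_subset unfolding singular_basis_def by blast+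
  note expand = orthonormal_expansion[OF oC fC x]
  have C1: "cinner b c = 0" if "b \<in> C" "c \<in> C" "b \<noteq> c" for b c
    using oC that by (auto simp: orthonormal_def)
  have "norm b = 1" if "b \<in> C" for b
  proof -
    have "complex_of_real ((norm b)\<^sup>2) = of_real 1"
      using oC that unfolding cinner_self[symmetric] by (simp add: orthonormal_def)
    then have "(norm b)\<^sup>2 = 1"
      unfolding of_real_eq_iff .
    then show ?thesis
      using norm_ge_zero[of b] by (simp add: power2_eq_1_iff)
  qed
  then show "(norm x)\<^sup>2 = (\<Sum>b\<in>C. (cmod (cinner b x))\<^sup>2)"
    using norm_sum_orthogonal[OF fC, of "\<lambda>b. b" "\<lambda>b. cinner b x"] C1 expand by simp
  have "T (\<Sum>b\<in>C. cinner b x *s b) = (\<Sum>b\<in>C. cinner b x *s T b)"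
    using T by (simp add: vec.linear_sum vec.linear_scale)
  then show "(norm (T x))\<^sup>2 = (\<Sum>b\<in>C. (cmod (cinner b x))\<^sup>2 * (norm (T b))\<^sup>2)"
    using norm_sum_orthogonal[OF fC, of T "\<lambda>b. cinner b x"] TC expand by simp
qed

text \<open>This subspace and the next one are the optimal ones in the max-min and the min-max
  characterization of the \<open>j\<close>-th singular value.\<close>

lemma singular_value_lower_subspace:
  assumes T: "clinear T" and V: "vec.subspace V" and j: "1 \<le> j" "j \<le> vec.dim V"
  obtains U where "vec.subspace U" "U \<subseteq> V" "j \<le> vec.dim U"
    "\<And>x. x \<in> U \<Longrightarrow> (singular_value V T j)\<^sup>2 * (norm x)\<^sup>2 \<le> (norm (T x))\<^sup>2"
proof -
  obtain B where B: "singular_basis V T B"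
    using exists_singular_basis[OF T V] by blast
  then have fB: "finite B" and oB: "orthonormal B" and sB: "vec.span B = V"
    by (auto simp: singular_basis_def)
  have cB: "card B = vec.dim V"
    using orthonormal_dim_span[OF oB fB] sB by simp
  let ?C = "{b \<in> B. singular_value V T j \<le> norm (T b)}"
  show ?thesis
  proof
    show "vec.span ?C \<subseteq> V"
      unfolding sB[symmetric] by (intro vec.span_mono) auto
    have "orthonormal ?C" "finite ?C"
      using oB fB orthonormal_subset[of B ?C] by auto
    then show "j \<le> vec.dim (vec.span ?C)"
      using singular_value_count(1)[OF T B j(1)] j cB orthonormal_dim_span[of ?C] by simp
    fix x assume x: "x \<in> vec.span ?C"
    have "?C \<subseteq> B"
      by auto
    note norms = norm_square_singular_basis[OF T B this x]
    show "(singular_value V T j)\<^sup>2 * (norm x)\<^sup>2 \<le> (norm (T x))\<^sup>2"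
      using singular_value_nonneg[OF T V j]
      unfolding norms sum_distrib_left
      by (intro sum_mono, subst mult.commute) (auto intro!: mult_left_mono power_mono)
  qed simp
qed

lemma singular_value_upper_subspace:
  assumes T: "clinear T" and V: "vec.subspace V" and j: "1 \<le> j" "j \<le> vec.dim V"
  obtains W where "vec.subspace W" "W \<subseteq> V" "vec.dim V < j + vec.dim W"
    "\<And>x. x \<in> W \<Longrightarrow> (norm (T x))\<^sup>2 \<le> (singular_value V T j)\<^sup>2 * (norm x)\<^sup>2"
proof -
  obtain B where B: "singular_basis V T B"
    using exists_singular_basis[OF T V] by blast
  then have fB: "finite B" and oB: "orthonormal B" and sB: "vec.span B = V"
    by (auto simp: singular_basis_def)
  have cB: "card B = vec.dim V"
    using orthonormal_dim_span[OF oB fB] sB by simp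
  let ?C = "{b \<in> B. norm (T b) \<le> singular_value V T j}"
  show ?thesis
  proof
    show "vec.span ?C \<subseteq> V"
      unfolding sB[symmetric] by (intro vec.span_mono) auto
    have "orthonormal ?C" "finite ?C"
      using oB fB orthonormal_subset[of B ?C] by auto
    then show "vec.dim V < j + vec.dim (vec.span ?C)"
      using singular_value_count(2)[OF T B j(1)] j cB orthonormal_dim_span[of ?C] by simp
    fix x assume x: "x \<in> vec.span ?C"
    have "?C \<subseteq> B"
      by auto
    note norms = norm_square_singular_basis[OF T B this x]
    show "(norm (T x))\<^sup>2 \<le> (singular_value V T j)\<^sup>2 * (norm x)\<^sup>2"
      unfolding norms sum_distrib_left
      by (intro sum_mono, subst mult.commute) (auto intro!: mult_left_mono power_mono)
  qed simp
qed

lemma subspaces_meet: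
  fixes U W :: "('a::field ^ 'n) set"
  assumes "vec.subspace U" "vec.subspace W" "CARD('n) < vec.dim U + vec.dim W"
  obtains x where "x \<in> U" "x \<in> W" "x \<noteq> 0"
proof -
  have "vec.dim {x + y |x y. x \<in> U \<and> y \<in> W} \<le> CARD('n)"
    by (rule dim_subset_UNIV_cart_gen)
  then have "vec.dim (U \<inter> W) \<noteq> 0"
    using vec.dim_sums_Int[OF assms(1,2)] assms(3) by linarith
  then have "\<not> U \<inter> W \<subseteq> {0}"
    unfolding vec.dim_eq_0 .
  then show ?thesis
    using that by blast
qed

text \<open>The lower subspace for \<open>T\<close> has dimension at least \<open>j\<close>, the upper subspace for \<open>R\<close> dimension at
  least \<open>vec.dim W - k + 1\<close>. The condition on indices says exactly that these numbers add up to more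
  than the dimension of the whole space, so that a common nonzero vector transfers the pointwise
  bound.\<close>

lemma singular_value_comparison:
  fixes T R :: "complex ^ 'n \<Rightarrow> complex ^ 'n"
  assumes T: "clinear T" and R: "clinear R" and V: "vec.subspace V" and W: "vec.subspace W"
    and j: "1 \<le> j" "j \<le> vec.dim V" and k: "1 \<le> k" "k \<le> vec.dim W"
    and codim: "CARD('n) + k \<le> vec.dim W + j"
    and le: "\<And>x. x \<in> V \<Longrightarrow> x \<in> W \<Longrightarrow> (norm (T x))\<^sup>2 \<le> (norm (R x))\<^sup>2 + \<gamma> * (norm x)\<^sup>2"
  shows "(singular_value V T j)\<^sup>2 \<le> (singular_value W R k)\<^sup>2 + \<gamma>"
proof -
  obtain V' where V': "vec.subspace V'" "V' \<subseteq> V" "j \<le> vec.dim V'"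
    and lower: "\<And>x. x \<in> V' \<Longrightarrow> (singular_value V T j)\<^sup>2 * (norm x)\<^sup>2 \<le> (norm (T x))\<^sup>2"
    using singular_value_lower_subspace[OF T V j] by blast
  obtain W' where W': "vec.subspace W'" "W' \<subseteq> W" "vec.dim W < k + vec.dim W'"
    and upper: "\<And>x. x \<in> W' \<Longrightarrow> (norm (R x))\<^sup>2 \<le> (singular_value W R k)\<^sup>2 * (norm x)\<^sup>2"
    using singular_value_upper_subspace[OF R W k] by blast
  have "CARD('n) < vec.dim V' + vec.dim W'"
    using codim V'(3) W'(3) by linarith
  then obtain x where x: "x \<in> V'" "x \<in> W'" "x \<noteq> 0"
    using subspaces_meet[OF V'(1) W'(1)] by blast
  have "(singular_value V T j)\<^sup>2 * (norm x)\<^sup>2 \<le> (norm (T x))\<^sup>2"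
    using lower x by blast
  also have "\<dots> \<le> (norm (R x))\<^sup>2 + \<gamma> * (norm x)\<^sup>2"
    using x V'(2) W'(2) by (intro le) auto
  also have "\<dots> \<le> ((singular_value W R k)\<^sup>2 + \<gamma>) * (norm x)\<^sup>2"
    using upper x by (simp add: distrib_right)
  finally show ?thesis
    using x(3) by (simp add: mult_le_cancel_right)
qed

section \<open>Compression to a hyperplane\<close>

text \<open>The compression is \<open>undefined\<close> outside the hyperplane, so it need not be linear on the whole
  space. Here a globally linear map may take its place.\<close>

lemma singular_value_cong:
  assumes "\<And>x. x \<in> V \<Longrightarrow> T x = R x"
  shows "singular_value V T = singular_value V R"
proof -
  have "adjoint_on V T = adjoint_on V R"
    using assms by (simp add: adjoint_on_def fun_eq_iff)
  then have "{x \<in> V. adjoint_on V T (T x) = c *s x} = {x \<in> V. adjoint_on V R (R x) = c *s x}" for c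
    using assms by auto
  then show ?thesis
    by (simp add: singular_value_def sing_mset_def sing_mult_def fun_eq_iff)
qed

lemma hyperplane_eq_orthogonal_complement:
  assumes S: "hyperplane S" and h: "norm h = 1" and orth: "\<forall>x\<in>S. cinner h x = 0"
  shows "S = {x. cinner h x = 0}"
proof -
  let ?H = "{x. cinner h x = 0}"
  have H: "vec.subspace ?H"
    by (auto simp: vec.subspace_def cinner_add_right cinner_scale_right)
  have "h \<notin> ?H"
    using h by (simp add: cinner_self)
  then have "vec.span ?H \<subset> vec.span UNIV"
    using H by (auto simp: vec.span_eq_iff[THEN iffD2])
  then have "vec.dim ?H < CARD('a)"
    using vec.dim_psubset vec_dim_card by metis
  with S H orth show ?thesis
    by (intro vec.subspace_dim_equal) (auto simp: hyperplane_def)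
qed

lemma orth_proj_orthogonal_complement:
  assumes h: "norm h = 1"
  shows "orth_proj {x. cinner h x = 0} x = x - cinner h x *s h"
  unfolding orth_proj_def
proof (rule the_equality)
  have hh: "cinner h h = 1"
    using h by (simp add: cinner_self)
  have zh: "cinner z h = 0" if "cinner h z = 0" for z
    using that cnj_cinner[of h z] by simp
  show 1: "x - cinner h x *s h \<in> {x. cinner h x = 0} \<and>
      (\<forall>z\<in>{x. cinner h x = 0}. cinner z (x - (x - cinner h x *s h)) = 0)"
    using hh zh by (simp add: cinner_diff_right cinner_scale_right)
  fix y assume y: "y \<in> {x. cinner h x = 0} \<and> (\<forall>z\<in>{x. cinner h x = 0}. cinner z (x - y) = 0)"
  let ?d = "(x - cinner h x *s h) - y"
  have "cinner h ?d = 0"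
    using 1 y by (simp add: cinner_diff_right)
  then have "cinner ?d (x - y) = 0" "cinner ?d h = 0"
    using y zh by auto
  then have "cinner ?d ?d = 0"
    using cinner_diff_right[of ?d "x - y" "cinner h x *s h"] cinner_scale_right[of ?d "cinner h x" h]
    by (simp add: algebra_simps)
  then show "y = x - cinner h x *s h"
    by (simp add: cinner_self)
qed

lemma norm_orthogonal_part:
  assumes h: "norm h = 1"
  shows "(norm (v - cinner h v *s h))\<^sup>2 = (norm v)\<^sup>2 - (cmod (cinner h v))\<^sup>2"
proof -
  have "cinner h h = 1"
    using h by (simp add: cinner_self)
  then have "cinner (v - cinner h v *s h) (v - cinner h v *s h) = cinner v v - cinner h v * cinner v h"
    by (simp add: cinner_diff_right cinner_diff_left cinner_scale_right cinner_scale_left algebra_simps)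
  also have "\<dots> = of_real ((norm v)\<^sup>2 - (cmod (cinner h v))\<^sup>2)"
    by (simp add: cinner_self complex_norm_square cnj_cinner del: of_real_power)
  finally show ?thesis
    unfolding cinner_self of_real_eq_iff .
qed

lemma normal_norm_adjoint:
  assumes "normal_matrix A"
  shows "norm (hermitian_adjoint A *v x) = norm (A *v x)"
proof -
  have adj: "cinner (A *v x) y = cinner x (hermitian_adjoint A *v y)" for x y
    by (metis cinner_adjoint cnj_cinner)
  have "cinner (hermitian_adjoint A *v x) (hermitian_adjoint A *v x)
      = cinner x ((A ** hermitian_adjoint A) *v x)"
    by (simp add: cinner_adjoint matrix_vector_mul_assoc)
  also have "\<dots> = cinner x ((hermitian_adjoint A ** A) *v x)"
    using assms by (simp add: normal_matrix_def)
  also have "\<dots> = cinner (A *v x) (A *v x)"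
    by (simp add: adj matrix_vector_mul_assoc)
  finally have "(norm (hermitian_adjoint A *v x))\<^sup>2 = (norm (A *v x))\<^sup>2"
    unfolding cinner_self of_real_eq_iff .
  then show ?thesis
    by (simp add: power2_eq_iff_nonneg)
qed

text \<open>For \<open>x\<close> orthogonal to \<open>h\<close>, the product \<open>cinner h (A *v x)\<close> is that of \<open>x\<close> with the component of
  \<open>A\<^sup>* h\<close> orthogonal to \<open>h\<close>. By normality the latter is as long as the corresponding component of
  \<open>A h\<close>, and the Cauchy-Schwarz inequality applies.\<close>

lemma normal_defect_bound:
  assumes A: "normal_matrix A" and h: "norm h = 1" and x: "cinner h x = 0"
  shows "(cmod (cinner h (A *v x)))\<^sup>2 \<le> ((norm (A *v h))\<^sup>2 - (cmod (cinner h (A *v h)))\<^sup>2) * (norm x)\<^sup>2"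
proof -
  define v where "v = hermitian_adjoint A *v h"
  have "cinner h (A *v x) = cinner (v - cinner h v *s h) x"
    using x by (simp add: v_def cinner_adjoint cinner_diff_left cinner_scale_left)
  then have "(cmod (cinner h (A *v x)))\<^sup>2 \<le> (norm (v - cinner h v *s h) * norm x)\<^sup>2"
    by (simp add: cinner_Cauchy_Schwarz power_mono)
  also have "\<dots> = ((norm v)\<^sup>2 - (cmod (cinner h v))\<^sup>2) * (norm x)\<^sup>2"
    by (simp add: power_mult_distrib norm_orthogonal_part[OF h])
  also have "norm v = norm (A *v h)"
    by (simp add: v_def normal_norm_adjoint[OF A])
  also have "cinner h v = cnj (cinner h (A *v h))"
    by (metis v_def cinner_adjoint cnj_cinner)
  finally show ?thesis
    by simp
qed

theorem corollary1p1:
  fixes A :: "complex ^ 'n ^ 'n" and S :: "(complex ^ 'n) set" and h :: "complex ^ 'n"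
    and \<beta> :: real and j :: nat
  assumes "normal_matrix A"
    and "hyperplane S"
    and "norm h = 1"
    and "\<forall>x\<in>S. cinner h x = 0"
    and "\<beta> = (norm (A *v h))\<^sup>2 - (cmod (cinner h (A *v h)))\<^sup>2"
    and "1 \<le> j" and "j \<le> CARD('n) - 1"
  shows "(singular_value UNIV ((*v) A) j)\<^sup>2 \<ge> (singular_value S (compression A S) j)\<^sup>2
    \<and> (singular_value S (compression A S) j)\<^sup>2 \<ge> (singular_value UNIV ((*v) A) (j + 1))\<^sup>2 - \<beta>"
proof -
  define C where "C x = A *v x - cinner h (A *v x) *s h" for x
  have S: "S = {x. cinner h x = 0}"
    using hyperplane_eq_orthogonal_complement assms(2-4) by blast
  have dims: "vec.subspace S" "vec.dim S = CARD('n) - 1" "vec.subspace (UNIV :: (complex ^ 'n) set)"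
    using assms(2) by (simp_all add: hyperplane_def)
  have A: "clinear ((*v) A)"
    by (rule matrix_vector_mul_linear_gen)
  have C: "clinear C"
    by (simp add: C_def clinear_iff matrix_vector_right_distrib vector_scalar_commute
        cinner_add_right cinner_scale_right vec.scale_left_distrib vec.scale_right_diff_distrib)
  have sv: "singular_value S (compression A S) = singular_value S C"
    by (rule singular_value_cong)
      (simp add: compression_def C_def S orth_proj_orthogonal_complement[OF assms(3)])
  have normC: "(norm (C x))\<^sup>2 = (norm (A *v x))\<^sup>2 - (cmod (cinner h (A *v x)))\<^sup>2" for x
    unfolding C_def by (rule norm_orthogonal_part[OF assms(3)])
  have "(singular_value S C j)\<^sup>2 \<le> (singular_value UNIV ((*v) A) j)\<^sup>2 + 0"
  proof (rule singular_value_comparison[OF C A dims(1,3)])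
    show "(norm (C x))\<^sup>2 \<le> (norm (A *v x))\<^sup>2 + 0 * (norm x)\<^sup>2" for x
      by (simp add: normC)
  qed (use assms dims in \<open>simp_all add: vec_dim_card del: vec.dim_UNIV\<close>)
  moreover have "(singular_value UNIV ((*v) A) (j + 1))\<^sup>2 \<le> (singular_value S C j)\<^sup>2 + \<beta>"
  proof (rule singular_value_comparison[OF A C dims(3,1)])
    show "(norm (A *v x))\<^sup>2 \<le> (norm (C x))\<^sup>2 + \<beta> * (norm x)\<^sup>2" if "x \<in> S" for x
      using normal_defect_bound[OF assms(1,3), of x] that
      by (simp add: normC S assms(5))
  qed (use assms dims in \<open>simp_all add: vec_dim_card del: vec.dim_UNIV\<close>)
  ultimately show ?thesis
    by (simp add: sv)
qed

end
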